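(* Let $A\in\mathbb{R}^{n\times n}$, $\mathbf{v},\mathbf{w}\in\mathbb{R}^n$, and $\hat A=A+\mathbf{v}\mathbf{w}^T$, and suppose that all leading principal minors of $A$ and of $\hat A$ are nonzero. Let $U$ and $\hat U$ be the upper-triangular factors of the REF-LU factorizations of $A$ and $\hat A$, respectively. Let $\mathbf{z}^{(k)}$ and $\hat{\mathbf{z}}^{(k)}$ be the intermediary forward substitution vectors obtained at the conclusion of the $k$th iteration of REF forward substitution on $\mathbf{w}$ using $U^T$ and $\hat U^T$, respectively. Then $\mathbf{z}^{(k)}=\hat{\mathbf{z}}^{(k)}$ for all $k=1,\dots,n-1$.
   Context: Let $M\in\mathbb{R}^{n\times n}$ have all leading principal minors nonzero. Integer-preserving Gaussian elimination (IPGE) on $M$ (no permutations): $m^{(0)}_{i,j}=m_{i,j}$, $\rho^{(0)}=1$, and for $k=1,\dots,n$, with pivot $\rho^{(k)}=m^{(k-1)}_{k,k}$, set, for $k\le i,j\le n$, $m^{(k)}_{i,j}=m^{(k-1)}_{i,j}$ if $i=k$, and $m^{(k)}_{i,j}=\bigl(\rho^{(k)}m^{(k-1)}_{i,j}-m^{(k-1)}_{k,j}m^{(k-1)}_{i,k}\bigr)/\rho^{(k-1)}$ otherwise. (The pivot $\rho^{(k)}$ equals the $k$th leading principal minor of $M$, hence is nonzero.) The REF-LU factorization of $M$ is the triple $L,D,U$ where $L$ is lower triangular with $l_{i,j}=m^{(j-1)}_{i,j}$ for $i\ge j$, $D$ is diagonal with $d_{i,i}=\rho^{(i-1)}\rho^{(i)}$,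 and $U$ is upper triangular with $u_{i,j}=m^{(i-1)}_{i,j}$ for $i\le j$; it satisfies $M=LD^{-1}U$ and $l_{i,i}=u_{i,i}=\rho^{(i)}$. REF forward substitution on a vector $\mathbf{b}$ using the lower-triangular matrix $U^T$ produces vectors $\mathbf{z}^{(0)}=\mathbf{b},\mathbf{z}^{(1)},\dots,\mathbf{z}^{(n-1)}$ by the following recursion, for $k=1,\dots,n-1$ and with the convention $u_{0,0}=1$: $z^{(k)}_i=z^{(k-1)}_i$ for $i\le k$, and $z^{(k)}_i=\bigl(u_{k,k}\,z^{(k-1)}_i-u_{k,i}\,z^{(k-1)}_k\bigr)/u_{k-1,k-1}$ for $i>k$. *)

theory Defs
  imports Jordan_Normal_Form.Determinant Jordan_Normal_Form.DL_Submatrix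
begin

text \<open>Rows and columns are numbered from 0, whereas the superscript $k$ of an iterate, the
  subscript of a pivot and the order of a leading principal minor keep their usual numbering:
  $m^{(k)}_{i,j}$ of the 1-based notation is \<open>ipge M k $$ (i - 1, j - 1)\<close>, and $\rho^{(k)}$
  is \<open>ipge_pivot M k\<close>.\<close>

definition leading_principal_minor :: "real mat \<Rightarrow> nat \<Rightarrow> real" where
  "leading_principal_minor M k = det (submatrix M {..<k} {..<k})"

definition leading_principal_minors_nonzero :: "real mat \<Rightarrow> bool" where
  "leading_principal_minors_nonzero M \<longleftrightarrow>
     (\<forall>k \<in> {1..dim_row M}. leading_principal_minor M k \<noteq> 0)"

text \<open>Step \<open>k + 1\<close> of the elimination has the (0-based) pivot row and pivot column \<open>k\<close>. It is
  only specified for row and column indices at least \<open>k\<close>; the other entries play no further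
  role and are copied here.\<close>

fun ipge :: "real mat \<Rightarrow> nat \<Rightarrow> real mat"
  and ipge_pivot :: "real mat \<Rightarrow> nat \<Rightarrow> real" where
  "ipge M 0 = M"
| "ipge M (Suc k) = mat (dim_row M) (dim_col M) (\<lambda>(i, j).
     if i \<le> k \<or> j < k then ipge M k $$ (i, j)
     else (ipge_pivot M (Suc k) * ipge M k $$ (i, j) - ipge M k $$ (k, j) * ipge M k $$ (i, k))
            / ipge_pivot M k)"
| "ipge_pivot M 0 = 1"
| "ipge_pivot M (Suc k) = ipge M k $$ (k, k)"

definition ref_lu :: "real mat \<Rightarrow> real mat \<times> real mat \<times> real mat" where
  "ref_lu M = (let n = dim_row M in
     (mat n n (\<lambda>(i, j). if j \<le> i then ipge M j $$ (i, j) else 0),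
      mat n n (\<lambda>(i, j). if i = j then ipge_pivot M i * ipge_pivot M (Suc i) else 0),
      mat n n (\<lambda>(i, j). if i \<le> j then ipge M i $$ (i, j) else 0)))"

text \<open>\<open>ref_forward_subst T b k\<close> is the vector $z^{(k)}$ obtained after iteration \<open>k\<close> with the
  lower triangular matrix \<open>T\<close>. For \<open>T = U\<^sup>T\<close>, the entry $u_{k,i}$ of the usual recursion is
  the $(i,k)$ entry of \<open>T\<close>. The first iteration divides by the conventional $u_{0,0} = 1$.\<close>

fun ref_forward_subst :: "real mat \<Rightarrow> real vec \<Rightarrow> nat \<Rightarrow> real vec" where
  "ref_forward_subst T b 0 = b"
| "ref_forward_subst T b (Suc k) = (let z = ref_forward_subst T b k in
     vec (dim_vec b) (\<lambda>i.
       if i \<le> k then z $ i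
       else (T $$ (k, k) * z $ i - T $$ (i, k) * z $ k)
              / (if k = 0 then 1 else T $$ (k - 1, k - 1))))"

end

theory Submission
  imports Defs
begin

text \<open>Forward substitution with \<open>U\<^sup>T\<close> is the elimination step applied to an extra row \<open>b\<close>.
  After \<open>k\<close> steps that row has become \<open>b\<close> times the \<open>k\<close>-th leading principal minor plus a
  combination of the first \<open>k\<close> rows of the matrix, and it vanishes in the first \<open>k\<close> columns. Hence its entry in column \<open>j\<close> is the minor
  formed by the first \<open>k\<close> rows together with \<open>b\<close> and the first \<open>k\<close> columns together with \<open>j\<close>.
  For \<open>b = w\<close> this minor does not change when multiples of \<open>w\<close> are added to the other rows.\<close>

fun eliminate :: "(nat \<Rightarrow> nat \<Rightarrow> real) \<Rightarrow> nat \<Rightarrow> (nat \<Rightarrow> real) \<Rightarrow> nat \<Rightarrow> real"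
  and pivot :: "(nat \<Rightarrow> nat \<Rightarrow> real) \<Rightarrow> nat \<Rightarrow> real" where
  "eliminate a 0 b j = b j"
| "eliminate a (Suc k) b j =
     (pivot a (Suc k) * eliminate a k b j - eliminate a k (a k) j * eliminate a k b k) / pivot a k"
| "pivot a 0 = 1"
| "pivot a (Suc k) = eliminate a k (a k) k"

definition leading_minor :: "(nat \<Rightarrow> nat \<Rightarrow> real) \<Rightarrow> nat \<Rightarrow> real" where
  "leading_minor a k = det (mat k k (\<lambda>(i, j). a i j))"

text \<open>The column index \<open>j\<close> may lie below \<open>k\<close>; a column is then
  repeated and the determinant is 0, as it must be for an annihilated entry.\<close>

definition bordered :: "(nat \<Rightarrow> nat \<Rightarrow> real) \<Rightarrow> nat \<Rightarrow> (nat \<Rightarrow> real) \<Rightarrow> nat \<Rightarrow> real mat" where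
  "bordered a k b j = mat (Suc k) (Suc k)
     (\<lambda>(r, c). (if r < k then a r else b) (if c < k then c else j))"

lemma bordered_carrier [simp]: "bordered a k b j \<in> carrier_mat (Suc k) (Suc k)"
  by (simp add: bordered_def)

lemma det_bordered_row: "det (bordered a k (a k) k) = leading_minor a (Suc k)"
  unfolding bordered_def leading_minor_def
  by (intro arg_cong[where f = det] eq_matI) (auto simp: less_Suc_eq)

lemma sum_lessThan_indicator:
  fixes f :: "nat \<Rightarrow> real"
  assumes "r < k"
  shows "(\<Sum>i<k. (if r = i then 1 else 0) * f i) = f r"
  using assms by (simp add: if_distrib[of "\<lambda>x. x * _"] cong: if_cong)

text \<open>The row operation is left multiplication by \<open>E\<close>, the identity with its last
  row replaced by \<open>(c, p)\<close>; it is lower triangular with determinant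
  \<open>p\<close>.\<close>

lemma det_bordered_combination:
  assumes "\<And>j. y j = p * b j + (\<Sum>r<k. c r * a r j)"
  shows "det (bordered a k y j) = p * det (bordered a k b j)"
proof -
  define E where "E = mat (Suc k) (Suc k)
    (\<lambda>(r, s). if r < k then (if r = s then 1 else 0) else if s < k then c s else p)"
  have E: "E \<in> carrier_mat (Suc k) (Suc k)"
    by (simp add: E_def)
  have "bordered a k y j = E * bordered a k b j"
  proof (rule eq_matI)
    fix r s assume "r < dim_row (E * bordered a k b j)" "s < dim_col (E * bordered a k b j)"
    then have "r < Suc k" "s < Suc k"
      by (auto simp: E_def bordered_def)
    then show "bordered a k y j $$ (r, s) = (E * bordered a k b j) $$ (r, s)"
      using assms
      by (auto simp: E_def bordered_def scalar_prod_def atLeast0LessThan sum_lessThan_indicator)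
  qed (auto simp: E_def bordered_def)
  moreover have "det E = p"
  proof -
    have "det E = prod_list (diag_mat E)"
      by (rule det_lower_triangular[OF _ E]) (auto simp: E_def)
    also have "\<dots> = (\<Prod>i<Suc k. E $$ (i, i))"
      using E by (simp add: prod_list_diag_prod atLeast0LessThan)
    also have "\<dots> = p"
      by (simp add: E_def)
    finally show ?thesis .
  qed
  ultimately show ?thesis
    using det_mult[OF E bordered_carrier[of a k b j]] by simp
qed

text \<open>The last row vanishes except in the corner, so the matrix is block upper
  triangular.\<close>

lemma det_bordered_zero:
  assumes "\<And>i. i < k \<Longrightarrow> y i = 0"
  shows "det (bordered a k y j) = leading_minor a k * y j"
proof -
  have "bordered a k y j = four_block_mat (mat k k (\<lambda>(r, s). a r s)) (mat k 1 (\<lambda>(r, s). a r j))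
      (0\<^sub>m 1 k) (mat 1 1 (\<lambda>_. y j))"
    by (rule eq_matI) (auto simp: bordered_def assms)
  also have "det \<dots> = leading_minor a k * det (mat 1 1 (\<lambda>_. y j))"
    unfolding leading_minor_def
    by (rule det_four_block_mat_lower_left_zero) auto
  also have "det (mat 1 1 (\<lambda>_. y j)) = y j"
    by (subst det_single) auto
  finally show ?thesis .
qed

text \<open>The three properties of the eliminated row are proved together because the value of the
  next pivot, needed for the induction step, comes from the determinant formula.\<close>

lemma eliminate_invariant:
  assumes "\<And>m. m < k \<Longrightarrow> leading_minor a (Suc m) \<noteq> 0"
  shows "pivot a k = leading_minor a k
    \<and> (\<forall>b. (\<exists>c. \<forall>j. eliminate a k b j = leading_minor a k * b j + (\<Sum>r<k. c r * a r j))
         \<and> (\<forall>j<k. eliminate a k b j = 0)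
         \<and> (\<forall>j. eliminate a k b j = det (bordered a k b j)))"
  using assms
proof (induction k)
  case 0
  have "b j = det (bordered a 0 b j)" for b j
    using det_bordered_zero[of 0 b a j] by (simp add: leading_minor_def)
  then show ?case
    by (simp add: leading_minor_def)
next
  case (Suc k)
  note IH = Suc.IH[OF Suc.prems[OF less_SucI]]
  have piv: "pivot a k = leading_minor a k"
    and comb: "\<And>b. \<exists>c. \<forall>j. eliminate a k b j = leading_minor a k * b j + (\<Sum>r<k. c r * a r j)"
    and zero: "\<And>b j. j < k \<Longrightarrow> eliminate a k b j = 0"
    and dt: "\<And>b j. eliminate a k b j = det (bordered a k b j)"
    using IH by meson+
  let ?p = "leading_minor a k" and ?q = "leading_minor a (Suc k)"
  \<comment> \<open>For \<open>k = 0\<close> this is the empty determinant, which is 1.\<close>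
  have p: "?p \<noteq> 0"
    using Suc.prems[of "k - 1"] by (cases k) (auto simp: leading_minor_def)
  have q: "?q \<noteq> 0"
    using Suc.prems by simp
  have piv': "pivot a (Suc k) = ?q"
    by (simp add: dt det_bordered_row)
  have step: "eliminate a (Suc k) b j
      = (?q * eliminate a k b j - eliminate a k (a k) j * eliminate a k b k) / ?p" for b j
    using piv' piv by simp
  have comb': "\<exists>c. \<forall>j. eliminate a (Suc k) b j = ?q * b j + (\<Sum>r<Suc k. c r * a r j)" for b
  proof -
    obtain c d where c: "\<And>j. eliminate a k b j = ?p * b j + (\<Sum>r<k. c r * a r j)"
      and d: "\<And>j. eliminate a k (a k) j = ?p * a k j + (\<Sum>r<k. d r * a r j)"
      using comb by meson
    let ?t = "eliminate a k b k"
    \<comment> \<open>Coefficients obtained by substituting both combinations into the step; for row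
      \<open>k\<close> the factor \<open>?p\<close> of \<open>d\<close> cancels the division and
      leaves \<open>- ?t\<close>.\<close>
    let ?e = "\<lambda>r. if r < k then (?q * c r - ?t * d r) / ?p else - ?t"
    have "eliminate a (Suc k) b j = ?q * b j + (\<Sum>r<Suc k. ?e r * a r j)" for j
    proof -
      have "(\<Sum>r<k. ?e r * a r j) = (?q * (\<Sum>r<k. c r * a r j) - ?t * (\<Sum>r<k. d r * a r j)) / ?p"
        unfolding sum_distrib_left sum_subtractf[symmetric] sum_divide_distrib
        by (intro sum.cong) (auto simp: field_simps)
      then show ?thesis
        unfolding step c[of j] d[of j] using p by (simp add: field_simps)
    qed
    then show ?thesis
      by (intro exI[of _ ?e]) blast
  qed
  \<comment> \<open>In the new case \<open>j = k\<close> the two products of the step agree, as the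
    pivot is \<open>eliminate a k (a k) k\<close>.\<close>
  have zero': "eliminate a (Suc k) b j = 0" if "j < Suc k" for b j
    using that zero piv' by (auto simp: less_Suc_eq)
  have dt': "eliminate a (Suc k) b j = det (bordered a (Suc k) b j)" for b j
  proof -
    obtain c where c: "\<And>j. eliminate a (Suc k) b j = ?q * b j + (\<Sum>r<Suc k. c r * a r j)"
      using comb' by blast
    \<comment> \<open>One determinant is evaluated twice: its last row is zero in the first
      \<open>Suc k\<close> columns, and is also a combination of \<open>b\<close> and the rows of
      \<open>a\<close>. Then \<open>?q\<close> cancels.\<close>
    have "?q * eliminate a (Suc k) b j = det (bordered a (Suc k) (eliminate a (Suc k) b) j)"
      using zero' by (intro det_bordered_zero[symmetric]) blast
    also have "\<dots> = ?q * det (bordered a (Suc k) b j)"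
      by (rule det_bordered_combination) (rule c)
    finally show ?thesis
      using q mult_left_cancel by blast
  qed
  show ?case
    using piv' comb' zero' dt' by blast
qed

lemma eliminate_eq_det:
  assumes "\<And>m. m < k \<Longrightarrow> leading_minor a (Suc m) \<noteq> 0"
  shows "eliminate a k b j = det (bordered a k b j)"
  using eliminate_invariant[OF assms] by blast

text \<open>Adding \<open>v r\<close> times the last row \<open>w\<close> to each row
  \<open>r < k\<close> is left multiplication by a unit upper triangular matrix.\<close>

lemma det_bordered_rank_one_update:
  "det (bordered (\<lambda>i j. a i j + v i * w j) k w j) = det (bordered a k w j)"
proof -
  define E where "E = mat (Suc k) (Suc k)
    (\<lambda>(r, s). if s < k then (if r = s then 1 else 0) else if r < k then v r else 1 :: real)"
  have E: "E \<in> carrier_mat (Suc k) (Suc k)"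
    by (simp add: E_def)
  have "bordered (\<lambda>i j. a i j + v i * w j) k w j = E * bordered a k w j"
  proof (rule eq_matI)
    fix r s assume "r < dim_row (E * bordered a k w j)" "s < dim_col (E * bordered a k w j)"
    then have "r < Suc k" "s < Suc k"
      by (auto simp: E_def bordered_def)
    then show "bordered (\<lambda>i j. a i j + v i * w j) k w j $$ (r, s) = (E * bordered a k w j) $$ (r, s)"
      by (auto simp: E_def bordered_def scalar_prod_def atLeast0LessThan sum_lessThan_indicator)
  qed (auto simp: E_def bordered_def)
  moreover have "det E = 1"
  proof -
    have "det E = prod_list (diag_mat E)"
      by (rule det_upper_triangular[OF _ E]) (auto simp: E_def)
    also have "\<dots> = (\<Prod>i<Suc k. E $$ (i, i))"
      using E by (simp add: prod_list_diag_prod atLeast0LessThan)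
    also have "\<dots> = 1"
      by (simp add: E_def)
    finally show ?thesis .
  qed
  ultimately show ?thesis
    using det_mult[OF E bordered_carrier[of a k w j]] by simp
qed

text \<open>Matrix entries are controlled only inside the dimensions, whereas the rank-one lemma
  speaks of functions on all indices; this bridges the two.\<close>

lemma det_bordered_cong:
  assumes "\<And>r i. r < k \<Longrightarrow> i < n \<Longrightarrow> a r i = a' r i" "\<And>i. i < n \<Longrightarrow> b i = b' i" "k < n" "j < n"
  shows "det (bordered a k b j) = det (bordered a' k b' j)"
  unfolding bordered_def
  using assms by (intro arg_cong[where f = det] eq_matI) auto

lemma pick_lessThan: "i < k \<Longrightarrow> pick {..<k} i = i"
proof -
  assume "i < k"
  then have "{a \<in> {..<k}. a < i} = {..<i}"
    by auto
  then show "pick {..<k} i = i"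
    using pick_card_in_set[of i "{..<k}"] \<open>i < k\<close> by simp
qed

lemma leading_principal_minor_eq:
  assumes "M \<in> carrier_mat n n" "k \<le> n"
  shows "leading_principal_minor M k = leading_minor (\<lambda>i j. M $$ (i, j)) k"
proof -
  have eq: "{i. i < n \<and> i < k} = {..<k}"
    using assms by auto
  show ?thesis
    unfolding leading_principal_minor_def leading_minor_def submatrix_def
    using assms by (intro arg_cong[where f = det] eq_matI) (auto simp: eq pick_lessThan)
qed

text \<open>The update of row \<open>i\<close> involves only that row and the pivot row, so each row
  can be eliminated by itself. The lower bounds exclude the entries that \<open>ipge\<close> merely
  copies.\<close>

lemma ipge_eq_eliminate:
  assumes "M \<in> carrier_mat n n"
  shows "(\<forall>i j. k \<le> i \<longrightarrow> k \<le> j \<longrightarrow> i < n \<longrightarrow> j < n \<longrightarrow>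
        ipge M k $$ (i, j) = eliminate (\<lambda>i j. M $$ (i, j)) k (\<lambda>j. M $$ (i, j)) j)
    \<and> (k \<le> n \<longrightarrow> ipge_pivot M k = pivot (\<lambda>i j. M $$ (i, j)) k)"
  using assms by (induction k) auto

text \<open>Forward substitution freezes entry \<open>i\<close> after iteration \<open>i\<close>, where \<open>eliminate\<close> would go on
  to annihilate it; hence the minimum.\<close>

lemma ref_forward_subst_eq_eliminate:
  assumes M: "M \<in> carrier_mat n n" and w: "w \<in> carrier_vec n"
    and lu: "ref_lu M = (L, D, U)" and "k < n"
  shows "ref_forward_subst U\<^sup>T w k
    = vec n (\<lambda>i. eliminate (\<lambda>i j. M $$ (i, j)) (min i k) (\<lambda>j. w $ j) i)"
proof -
  let ?a = "\<lambda>i j. M $$ (i, j)"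
  have dims: "dim_row U = n" "dim_col U = n"
    using lu M by (auto simp: ref_lu_def Let_def)
  have U: "U $$ (i, j) = eliminate ?a i (?a i) j" if "i \<le> j" "j < n" for i j
    using that lu M ipge_eq_eliminate[OF M, of i] by (auto simp: ref_lu_def Let_def)
  show ?thesis
    using \<open>k < n\<close>
  proof (induction k)
    case 0
    then show ?case
      using w by auto
  next
    case (Suc k)
    \<comment> \<open>The conventional first divisor matches \<open>pivot ?a 0 = 1\<close>; later
      divisors are diagonal entries of \<open>U\<close>, which are pivots.\<close>
    have piv: "(if k = 0 then 1 else U\<^sup>T $$ (k - 1, k - 1)) = pivot ?a k"
      using Suc.prems dims U by (cases k) auto
    have min: "min i k = k" "min i (Suc k) = Suc k" if "\<not> i \<le> k" for i
      using that by auto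
    have min': "min i k = i" "min i (Suc k) = i" if "i \<le> k" for i
      using that by auto
    show ?case
      using Suc w dims U piv
      by (intro eq_vecI) (auto simp: Let_def min min')
  qed
qed

theorem theorem6:
  fixes n :: nat and A A' L D U L' D' U' :: "real mat" and v w :: "real vec"
  assumes "A \<in> carrier_mat n n" and "v \<in> carrier_vec n" and "w \<in> carrier_vec n"
    and "A' = A + mat_of_cols n [v] * transpose_mat (mat_of_cols n [w])"
    and "leading_principal_minors_nonzero A"
    and "leading_principal_minors_nonzero A'"
    and "ref_lu A = (L, D, U)"
    and "ref_lu A' = (L', D', U')"
  shows "\<forall>k \<in> {1..n - 1}.
    ref_forward_subst (transpose_mat U) w k = ref_forward_subst (transpose_mat U') w k"
proof
  fix k assume "k \<in> {1..n - 1}"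
  then have k: "k < n"
    by auto
  let ?a = "\<lambda>i j. A $$ (i, j)" and ?a' = "\<lambda>i j. A' $$ (i, j)" and ?w = "\<lambda>j. w $ j"
  have A': "A' \<in> carrier_mat n n"
    using assms(1,4) by auto
  have a': "?a' i j = ?a i j + v $ i * w $ j" if "i < n" "j < n" for i j
    using that assms(1-4) by (auto simp: mat_of_cols_def scalar_prod_def)
  \<comment> \<open>All \<open>m < n\<close> are needed, since entry \<open>i\<close> has undergone
    \<open>min i k\<close> steps rather than \<open>k\<close>.\<close>
  have "eliminate ?a m ?w i = eliminate ?a' m ?w i" if "i < n" "m < n" for i m
  proof -
    have "leading_minor ?a (Suc l) \<noteq> 0" "leading_minor ?a' (Suc l) \<noteq> 0" if "l < m" for l
      using that \<open>m < n\<close> assms(5,6) leading_principal_minor_eq[OF assms(1), of "Suc l"]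
        leading_principal_minor_eq[OF A', of "Suc l"] assms(1) A'
      by (auto simp: leading_principal_minors_nonzero_def)
    then have "eliminate ?a m ?w i = det (bordered ?a m ?w i)"
      and "eliminate ?a' m ?w i = det (bordered ?a' m ?w i)"
      by (intro eliminate_eq_det; blast)+
    moreover have "det (bordered ?a' m ?w i)
        = det (bordered (\<lambda>i j. ?a i j + v $ i * ?w j) m ?w i)"
      using that a' by (intro det_bordered_cong[where n = n]) auto
    ultimately show ?thesis
      by (simp add: det_bordered_rank_one_update)
  qed
  then show "ref_forward_subst U\<^sup>T w k = ref_forward_subst U'\<^sup>T w k"
    using ref_forward_subst_eq_eliminate[OF assms(1,3,7) k]
      ref_forward_subst_eq_eliminate[OF A' assms(3,8) k] k
    by auto
qed

end
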